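(* Let $m\ge 1$, $C\ge 1$, $s^{(0)}\in\{0,\dots,C\}$, $d^{(1)},\dots,d^{(m)}\in\mathbb Z$, let $1=e_1<e_2<\dots<e_w\le m$ ($w\ge1$) be the visiting epochs, and let $0\le q_i\le Q_i$ ($i=1,\dots,w$) be integers. Consider the linear relaxation of the one-station bike repositioning problem, i.e. the problem of minimizing the total loss $L(\boldsymbol x)$ over all real vectors $\boldsymbol x=[x_1,\dots,x_w]$ with $x_i\in[q_i-Q_i,q_i]$ for all $i$ (the integrality conditions $x_i\in\mathbb Z$ being removed). Then this relaxed problem always has an integer solution: there is $\boldsymbol x^*\in\mathbb Z^w$ with $x_i^*\in[q_i-Q_i,q_i]$ for all $i$ such that $L(\boldsymbol x^* )\le L(\boldsymbol x)$ for every real vector $\boldsymbol x$ with $x_i\in[q_i-Q_i,q_i]$ for all $i$.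
   Context: A station has capacity $C$ and initial stock $s^{(0)}$. At epoch $h\in\{1,\dots,m\}$ it receives a net flow $d^{(h)}$ of bikes. At epoch $e_i$ vehicle $i$, with capacity $Q_i$ and load $q_i$, moves $x_i$ bikes to the station (from the station if $x_i<0$). Given $\boldsymbol x=[x_1,\dots,x_w]$, define recursively for $h=1,\dots,m$, with $s^{(0)}(\boldsymbol x)=s^{(0)}$: the virtual stock $\hat s^{(h)}(\boldsymbol x)=s^{(h-1)}(\boldsymbol x)+d^{(h)}+x_i$ if $h=e_i$ for some $i$, and $\hat s^{(h)}(\boldsymbol x)=s^{(h-1)}(\boldsymbol x)+d^{(h)}$ if $h\notin\{e_1,\dots,e_w\}$; the surplus loss $l^{(h)+}(\boldsymbol x)=\max(0,\hat s^{(h)}(\boldsymbol x)-C)$; the stockout loss $l^{(h)-}(\boldsymbol x)=\max(0,-\hat s^{(h)}(\boldsymbol x))$; the stock $s^{(h)}(\boldsymbol x)=\hat s^{(h)}(\boldsymbol x)-l^{(h)+}(\boldsymbol x)+l^{(h)-}(\boldsymbol x)\in[0,C]$. The total loss is $L(\boldsymbol x)=\sum_{h=1}^m\big(l^{(h)+}(\boldsymbol x)+l^{(h)-}(\boldsymbol x)\big)$. The one-station bike repositioning problem is to minimize $L(\boldsymbol x)$ subject to $x_i\in[q_i-Q_i,q_i]$ and $x_i\in\mathbb Z$ for all $i$. *)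

theory Defs
  imports Complex_Main
begin

(* Conventions.  Epochs and vehicles are numbered from 1; d h, e i, q i, Q i and x i are
   relevant only for h in {1..m} and i in {1..w}.  A vector of repositioning quantities is a
   function x :: nat => real whose values outside {1..w} play no role.  The instance data are
   integers; x, and hence stocks and losses, are real so that the relaxation can be stated. *)

(* The description of i is meaningful when e is injective on {1..w}. *)
definition moved :: "nat \<Rightarrow> (nat \<Rightarrow> nat) \<Rightarrow> (nat \<Rightarrow> real) \<Rightarrow> nat \<Rightarrow> real" where
  "moved w e x h =
     (if \<exists>i\<in>{1..w}. h = e i then x (THE i. i \<in> {1..w} \<and> h = e i) else 0)"

definition surplus :: "int \<Rightarrow> real \<Rightarrow> real" where
  "surplus C v = max 0 (v - of_int C)"

definition stockout :: "real \<Rightarrow> real" where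
  "stockout v = max 0 (- v)"

(* The let-bound v is the virtual stock of epoch Suc h; it reappears as virtual_stock below. *)
primrec stock ::
  "int \<Rightarrow> int \<Rightarrow> (nat \<Rightarrow> int) \<Rightarrow> nat \<Rightarrow> (nat \<Rightarrow> nat) \<Rightarrow> (nat \<Rightarrow> real) \<Rightarrow> nat \<Rightarrow> real" where
  "stock C s0 d w e x 0 = of_int s0"
| "stock C s0 d w e x (Suc h) =
     (let v = stock C s0 d w e x h + of_int (d (Suc h)) + moved w e x (Suc h)
      in v - surplus C v + stockout v)"

(* Intended for h >= 1 only. *)
definition virtual_stock ::
  "int \<Rightarrow> int \<Rightarrow> (nat \<Rightarrow> int) \<Rightarrow> nat \<Rightarrow> (nat \<Rightarrow> nat) \<Rightarrow> (nat \<Rightarrow> real) \<Rightarrow> nat \<Rightarrow> real" where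
  "virtual_stock C s0 d w e x h =
     stock C s0 d w e x (h - 1) + of_int (d h) + moved w e x h"

definition surplus_loss ::
  "int \<Rightarrow> int \<Rightarrow> (nat \<Rightarrow> int) \<Rightarrow> nat \<Rightarrow> (nat \<Rightarrow> nat) \<Rightarrow> (nat \<Rightarrow> real) \<Rightarrow> nat \<Rightarrow> real" where
  "surplus_loss C s0 d w e x h = surplus C (virtual_stock C s0 d w e x h)"

definition stockout_loss ::
  "int \<Rightarrow> int \<Rightarrow> (nat \<Rightarrow> int) \<Rightarrow> nat \<Rightarrow> (nat \<Rightarrow> nat) \<Rightarrow> (nat \<Rightarrow> real) \<Rightarrow> nat \<Rightarrow> real" where
  "stockout_loss C s0 d w e x h = stockout (virtual_stock C s0 d w e x h)"

definition total_loss ::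
  "nat \<Rightarrow> int \<Rightarrow> int \<Rightarrow> (nat \<Rightarrow> int) \<Rightarrow> nat \<Rightarrow> (nat \<Rightarrow> nat) \<Rightarrow> (nat \<Rightarrow> real) \<Rightarrow> real" where
  "total_loss m C s0 d w e x =
     (\<Sum>h=1..m. surplus_loss C s0 d w e x h + stockout_loss C s0 d w e x h)"

definition relaxed_feasible ::
  "nat \<Rightarrow> (nat \<Rightarrow> int) \<Rightarrow> (nat \<Rightarrow> int) \<Rightarrow> (nat \<Rightarrow> real) \<Rightarrow> bool" where
  "relaxed_feasible w q Q x \<longleftrightarrow>
     (\<forall>i\<in>{1..w}. x i \<in> {of_int (q i - Q i)..of_int (q i)})"

lemma moved_visit:
  assumes "inj_on e {1..w}" "i \<in> {1..w}"
  shows "moved w e x (e i) = x i"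
proof -
  have "(THE j. j \<in> {1..w} \<and> e i = e j) = i"
    using assms by (intro the_equality) (auto dest: inj_onD)
  then show ?thesis using assms(2) by (auto simp: moved_def)
qed

lemma moved_no_visit: "h \<notin> e ` {1..w} \<Longrightarrow> moved w e x h = 0"
  by (auto simp: moved_def)

lemma stock_rec:
  assumes "h \<ge> 1"
  shows "stock C s0 d w e x h =
    virtual_stock C s0 d w e x h - surplus_loss C s0 d w e x h + stockout_loss C s0 d w e x h"
  using assms
  by (cases h) (simp_all add: virtual_stock_def surplus_loss_def stockout_loss_def Let_def)

lemma stock_range:
  assumes "0 \<le> s0" "s0 \<le> C"
  shows "stock C s0 d w e x h \<in> {0..of_int C}"
  using assms by (cases h) (auto simp: Let_def surplus_def stockout_def)

end

theory Submission
  imports Defs "HOL-Analysis.Equivalence_Lebesgue_Henstock_Integration"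
begin

text \<open>
  Randomised rounding with one common threshold.  For \<open>\<theta> \<in> [0, 1)\<close> let
  \<open>\<rho> v = \<lfloor>v + \<theta>\<rfloor>\<close>.  Since \<open>0\<close> and \<open>C\<close> are integers, \<open>\<rho>\<close> commutes with the
  truncation to \<open>[0, C]\<close>, so moving \<open>\<rho> (virtual stock) - \<rho> (previous stock) - d\<close> bikes at each
  visit turns every stock and virtual stock of a relaxed solution \<open>x\<close> into its image under
  \<open>\<rho>\<close>; these moves are roundings of the \<open>x i\<close> and hence respect the integer bounds.
  The loss at an epoch is affine in the virtual stock between consecutive integers and the mean
  of \<open>\<lfloor>v + \<theta>\<rfloor>\<close> over \<open>\<theta>\<close> is \<open>v\<close>, so \<open>total_loss x\<close> is the mean of the
  losses of integer solutions and cannot be smaller than the least of them.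
\<close>

definition loss :: "int \<Rightarrow> real \<Rightarrow> real" where
  "loss C v = surplus C v + stockout v"

lemma total_loss_eq: "total_loss m C s0 d w e x = (\<Sum>h=1..m. loss C (virtual_stock C s0 d w e x h))"
  by (simp add: total_loss_def loss_def surplus_loss_def stockout_loss_def)

text \<open>\<open>loss\<close> has its only kinks at the integers \<open>0\<close> and
  \<open>C\<close>, so no kink lies strictly between \<open>k\<close> and
  \<open>k + 1\<close>.\<close>

lemma loss_affine_between_integers:
  assumes "0 \<le> C" and "0 \<le> p" "p \<le> 1"
  shows "loss C (of_int k + p) = loss C (of_int k) + p * (loss C (of_int (k + 1)) - loss C (of_int k))"
proof -
  consider "k < 0" | "0 \<le> k" "k < C" | "C \<le> k" by linarith
  then show ?thesis
  proof cases
    case 1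
    then have "real_of_int k + 1 \<le> 0" "real_of_int k + 1 \<le> of_int C"
      using assms(1) by linarith+
    then have "loss C (of_int k + p') = - (of_int k + p')" if "p' \<le> 1" for p'
      using that by (simp add: loss_def surplus_def stockout_def)
    from this[of p] this[of 0] this[of 1] show ?thesis
      using assms by simp
  next
    case 2
    then have "real_of_int k \<ge> 0" "real_of_int k + 1 \<le> of_int C" by linarith+
    then have "loss C (of_int k + p') = 0" if "0 \<le> p'" "p' \<le> 1" for p'
      using that by (simp add: loss_def surplus_def stockout_def)
    from this[of p] this[of 0] this[of 1] show ?thesis
      using assms by simp
  next
    case 3
    then have "real_of_int k \<ge> 0" "real_of_int k \<ge> of_int C" using assms(1) by linarith+
    then have "loss C (of_int k + p') = of_int k + p' - of_int C" if "0 \<le> p'" for p'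
      using that by (simp add: loss_def surplus_def stockout_def)
    from this[of p] this[of 0] this[of 1] show ?thesis
      using assms by simp
  qed
qed

text \<open>A carry to the next integer occurs exactly when \<open>frac v\<close> and
  \<open>t\<close> add up to at least 1. For integer \<open>v\<close> the interval is the single
  point 1, which \<open>t\<close> never reaches.\<close>

lemma floor_add_threshold:
  fixes v t :: real
  assumes "0 < t" "t < 1"
  shows "\<lfloor>v + t\<rfloor> = \<lfloor>v\<rfloor> + (if t \<in> {1 - frac v..1} then 1 else 0)"
  using assms by (auto simp: floor_eq_iff frac_def) linarith+

lemma has_integral_loss_floor:
  assumes "0 \<le> C"
  shows "((\<lambda>t. loss C (of_int \<lfloor>v + t\<rfloor>)) has_integral loss C v) {0<..<1}"
proof -
  define k where "k = \<lfloor>v\<rfloor>"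
  define D where "D = loss C (of_int (k + 1)) - loss C (of_int k)"
  have p: "0 \<le> frac v" "frac v < 1" by (auto simp: frac_lt_1)
  \<comment> \<open>The thresholds that round \<open>v\<close> up form an interval of length
    \<open>frac v\<close>, so the mean loss is the linear interpolation at
    \<open>frac v\<close>.\<close>
  have "((\<lambda>t::real. 1::real) has_integral frac v) {1 - frac v..1}"
    using has_integral_const_real[of "1::real" "1 - frac v" 1] p by simp
  then have "((\<lambda>t::real. if t \<in> {1 - frac v..1} then 1 else 0 :: real) has_integral frac v) {0..1}"
    using p by (subst has_integral_restrict) auto
  then have "((\<lambda>t. loss C (of_int k) + D * (if t \<in> {1 - frac v..1} then 1 else 0))
      has_integral loss C (of_int k) + D * frac v) {0..1}"
    using has_integral_add[OF has_integral_const_real[of "loss C (of_int k)" 0 1] has_integral_mult_right]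
    by fastforce
  moreover have "loss C (of_int k) + D * frac v = loss C v"
    using loss_affine_between_integers[of C "frac v" k] assms p
    by (simp add: k_def D_def frac_def mult.commute)
  \<comment> \<open>Dropping the endpoints leaves the integral unchanged. The threshold
    \<open>t = 1\<close> must be avoided later, since it would shift every integer up by
    one.\<close>
  ultimately have "((\<lambda>t. loss C (of_int k) + D * (if t \<in> {1 - frac v..1} then 1 else 0))
      has_integral loss C v) {0<..<1}"
    by (simp only: has_integral_Icc_iff_Ioo)
  then show ?thesis
    by (rule has_integral_eq[rotated]) (auto simp: floor_add_threshold k_def D_def)
qed

text \<open>The restriction to \<open>{1..w}\<close> fixes the values elsewhere, so that the move
  vectors within the bounds lie in a finite \<open>PiE\<close> set.\<close>

definition rounded_moves ::
  "int \<Rightarrow> int \<Rightarrow> (nat \<Rightarrow> int) \<Rightarrow> nat \<Rightarrow> (nat \<Rightarrow> nat) \<Rightarrow> (nat \<Rightarrow> real) \<Rightarrow> real \<Rightarrow> nat \<Rightarrow> int" where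
  "rounded_moves C s0 d w e x t = (\<lambda>i\<in>{1..w}.
     \<lfloor>virtual_stock C s0 d w e x (e i) + t\<rfloor> - \<lfloor>stock C s0 d w e x (e i - 1) + t\<rfloor> - d (e i))"

text \<open>Rounding is monotone and, as 0 \<le> \<open>t\<close> < 1, fixes \<open>0\<close> and
  \<open>C\<close>. Hence a value below, between or above these bounds stays there, at worst landing
  on a bound, and clipping may be done before or after rounding.\<close>

lemma floor_truncate:
  fixes v t :: real
  assumes "0 \<le> C" "0 \<le> t" "t < 1"
  shows "of_int \<lfloor>v + t\<rfloor> - surplus C (of_int \<lfloor>v + t\<rfloor>) + stockout (of_int \<lfloor>v + t\<rfloor>)
    = of_int \<lfloor>(v - surplus C v + stockout v) + t\<rfloor>"
proof -
  consider "v < 0" | "0 \<le> v" "v \<le> of_int C" | "of_int C < v" by linarith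
  then show ?thesis
  proof cases
    case 1
    then have "\<lfloor>v + t\<rfloor> \<le> 0" "\<lfloor>v + t\<rfloor> \<le> C" "v \<le> of_int C" "\<lfloor>t\<rfloor> = 0"
      using assms by linarith+
    then show ?thesis using 1 by (simp add: surplus_def stockout_def)
  next
    case 2
    then have "\<lfloor>v + t\<rfloor> \<ge> 0" "\<lfloor>v + t\<rfloor> \<le> C" using assms by linarith+
    then show ?thesis using 2 by (simp add: surplus_def stockout_def)
  next
    case 3
    then have "\<lfloor>v + t\<rfloor> \<ge> C" "\<lfloor>v + t\<rfloor> \<ge> 0" "v \<ge> 0" "\<lfloor>of_int C + t\<rfloor> = C" using assms by linarith+
    then show ?thesis using 3 by (simp add: surplus_def stockout_def)
  qed
qed

context
  fixes C s0 :: int and d :: "nat \<Rightarrow> int" and w :: nat and e :: "nat \<Rightarrow> nat"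
    and x :: "nat \<Rightarrow> real" and t :: real
  assumes inj: "inj_on e {1..w}" and C: "0 \<le> C" and t: "0 \<le> t" "t < 1"
begin

text \<open>At a visit the move is by definition the missing difference; at any other epoch only the
  integer \<open>d h\<close> is added, which passes through the floor.\<close>

lemma rounded_move_step:
  assumes "h \<ge> 1"
  shows "of_int \<lfloor>stock C s0 d w e x (h - 1) + t\<rfloor> + of_int (d h)
      + moved w e (\<lambda>i. of_int (rounded_moves C s0 d w e x t i)) h
    = of_int \<lfloor>virtual_stock C s0 d w e x h + t\<rfloor>"
proof (cases "h \<in> e ` {1..w}")
  case True
  then obtain i where "i \<in> {1..w}" "h = e i" by blast
  then show ?thesis using moved_visit[OF inj] by (simp add: rounded_moves_def)
next
  case False
  then have "virtual_stock C s0 d w e x h + t = (stock C s0 d w e x (h - 1) + t) + of_int (d h)"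
    by (simp add: moved_no_visit virtual_stock_def)
  then show ?thesis
    by (simp only: floor_add_int[symmetric] moved_no_visit[OF False] of_int_add add_0_right)
qed

lemma stock_rounded_moves:
  "stock C s0 d w e (\<lambda>i. of_int (rounded_moves C s0 d w e x t i)) h
    = of_int \<lfloor>stock C s0 d w e x h + t\<rfloor>"
proof (induction h)
  case 0
  \<comment> \<open>The initial stock is an integer, so a threshold below 1 leaves it
    unchanged.\<close>
  show ?case using t by (simp add: floor_eq_iff)
next
  case (Suc h)
  show ?case
    using rounded_move_step[of "Suc h"] floor_truncate[OF C t, of "virtual_stock C s0 d w e x (Suc h)"]
    by (simp add: Suc.IH Let_def virtual_stock_def)
qed

lemma virtual_stock_rounded_moves:
  assumes "h \<ge> 1"
  shows "virtual_stock C s0 d w e (\<lambda>i. of_int (rounded_moves C s0 d w e x t i)) h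
    = of_int \<lfloor>virtual_stock C s0 d w e x h + t\<rfloor>"
  using rounded_move_step[OF assms] unfolding virtual_stock_def stock_rounded_moves by simp

text \<open>A difference of two floors is less than 1 away from the difference of their arguments.
  So each rounded move is an integer at distance less than 1 from \<open>x i\<close> and cannot
  cross an integer bound.\<close>

lemma rounded_moves_bounds:
  assumes "relaxed_feasible w q Q x"
  shows "rounded_moves C s0 d w e x t \<in> (\<Pi>\<^sub>E i\<in>{1..w}. {q i - Q i..q i})"
proof -
  have "rounded_moves C s0 d w e x t i \<in> {q i - Q i..q i}" if i: "i \<in> {1..w}" for i
  proof -
    have "of_int (q i - Q i) \<le> x i" "x i \<le> of_int (q i)"
      using assms i by (auto simp: relaxed_feasible_def)
    moreover have "virtual_stock C s0 d w e x (e i) = stock C s0 d w e x (e i - 1) + of_int (d (e i)) + x i"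
      using moved_visit[OF inj i] by (simp add: virtual_stock_def)
    ultimately show ?thesis
      using i unfolding rounded_moves_def by simp linarith
  qed
  then show ?thesis by (auto simp: rounded_moves_def)
qed

end

lemma has_integral_total_loss_rounded_moves:
  assumes "inj_on e {1..w}" "0 \<le> C"
  shows "((\<lambda>t. total_loss m C s0 d w e (\<lambda>i. of_int (rounded_moves C s0 d w e x t i)))
    has_integral total_loss m C s0 d w e x) {0<..<1}"
proof -
  \<comment> \<open>The total loss is a sum over epochs, so linearity suffices: it does not matter
    that all epochs share one threshold.\<close>
  have "((\<lambda>t. \<Sum>h=1..m. loss C (of_int \<lfloor>virtual_stock C s0 d w e x h + t\<rfloor>))
      has_integral total_loss m C s0 d w e x) {0<..<1}"
    unfolding total_loss_eq by (intro has_integral_sum has_integral_loss_floor assms) auto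
  then show ?thesis
    by (rule has_integral_eq[rotated])
      (auto simp: total_loss_eq virtual_stock_rounded_moves[OF assms] intro!: sum.cong)
qed

theorem theorem1:
  fixes m w :: nat and C s0 :: int and d q Q :: "nat \<Rightarrow> int" and e :: "nat \<Rightarrow> nat"
  assumes "m \<ge> 1" and "C \<ge> 1" and "s0 \<in> {0..C}"
    and "w \<ge> 1" and "e 1 = 1" and "strict_mono_on {1..w} e" and "e w \<le> m"
    and "\<And>i. i \<in> {1..w} \<Longrightarrow> 0 \<le> q i \<and> q i \<le> Q i"
  shows "\<exists>z :: nat \<Rightarrow> int.
    relaxed_feasible w q Q (\<lambda>i. of_int (z i)) \<and>
    (\<forall>x :: nat \<Rightarrow> real. relaxed_feasible w q Q x \<longrightarrow>
       total_loss m C s0 d w e (\<lambda>i. of_int (z i)) \<le> total_loss m C s0 d w e x)"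
proof -
  define Z where "Z = (\<Pi>\<^sub>E i\<in>{1..w}. {q i - Q i..q i})"
  define L where "L z = total_loss m C s0 d w e (\<lambda>i. of_int (z i))" for z :: "nat \<Rightarrow> int"
  have inj: "inj_on e {1..w}"
    using assms(6) by (rule strict_mono_on_imp_inj_on)
  \<comment> \<open>A minimum over integer vectors is attained because there are only finitely many
    within the bounds.\<close>
  have "finite Z" unfolding Z_def by (intro finite_PiE) auto
  moreover have "Z \<noteq> {}" using assms(8) by (force simp: Z_def PiE_eq_empty_iff)
  ultimately obtain z where z: "z \<in> Z" and min: "\<And>y. y \<in> Z \<Longrightarrow> L z \<le> L y"
    by (metis arg_min_if_finite(1) arg_min_least)
  have "relaxed_feasible w q Q (\<lambda>i. of_int (z i))"
    unfolding relaxed_feasible_def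
  proof
    fix i assume "i \<in> {1..w}"
    then have "z i \<in> {q i - Q i..q i}" using z unfolding Z_def by (rule PiE_mem[rotated])
    then show "real_of_int (z i) \<in> {of_int (q i - Q i)..of_int (q i)}"
      unfolding atLeastAtMost_iff of_int_le_iff .
  qed
  moreover have "L z \<le> total_loss m C s0 d w e x" if x: "relaxed_feasible w q Q x" for x
  \<comment> \<open>On an interval of length 1 the constant \<open>L z\<close> has integral
    \<open>L z\<close>, so comparing it with each rounded solution bounds their mean, the loss of
    \<open>x\<close>.\<close>
  proof (rule has_integral_le)
    show "((\<lambda>t::real. L z) has_integral L z) {0<..<1}"
      using has_integral_const_real[of "L z" 0 1] by (simp add: has_integral_Icc_iff_Ioo)
    show "((\<lambda>t. L (rounded_moves C s0 d w e x t)) has_integral total_loss m C s0 d w e x) {0<..<1}"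
      unfolding L_def using inj assms(2) by (intro has_integral_total_loss_rounded_moves) auto
    show "L z \<le> L (rounded_moves C s0 d w e x t)" if "t \<in> {0<..<1}" for t
      using that assms(2)
      by (intro min, unfold Z_def, intro rounded_moves_bounds inj x) auto
  qed
  ultimately show ?thesis unfolding L_def by blast
qed

end
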